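(* Let $p>1$ be a real number and $n>1$ an integer, let $p'=p/(p-1)$, and suppose that $p<n$. Then $$\mu(p',n)=\frac{\pi_{p,n}}{2\left(\sin\frac{\pi}{p}\cot\frac{\pi}{n}-\cos\frac{\pi}{p}\right)}\quad\text{and}\quad \nu(p',n)=\frac{\pi_{p,n}}{2\left(\cos\frac{\pi}{n}-\sin\frac{\pi}{n}\cot\frac{\pi}{p}\right)}.$$
   Context: Notation: $p':=p/(p-1)$ is the conjugate of $p$, so $\frac1p+\frac1{p'}=1$; $$\pi_{p,n}:=2\int_0^1\frac{1}{(1-t^n)^{1/p}}\,dt,\qquad \mu(m,n):=\int_1^\infty \frac{1}{(t^n-1)^{(m-1)/m}}\,dt,\qquad \nu(m,n):=\int_0^\infty \frac{1}{(1+t^n)^{(m-1)/m}}\,dt,$$ where $m>1$ is real. Here $\sin$, $\cos$, $\cot$ are the ordinary trigonometric functions and $\pi$ is the ordinary constant. *)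

theory Defs
  imports "HOL-Analysis.Analysis"
begin

text \<open>
  All integrands below are nonnegative, so the Henstock--Kurzweil integral agrees with the
  Lebesgue integral and with the improper Riemann integral wherever these converge.  At an endpoint
  singularity the integrand takes the junk value 0 (division by zero), which does not affect the
  integral.
\<close>

definition conj_exponent :: "real \<Rightarrow> real" where
  "conj_exponent p = p / (p - 1)"

definition pi_pn :: "real \<Rightarrow> nat \<Rightarrow> real" where
  "pi_pn p n = 2 * integral {0..1} (\<lambda>t. 1 / (1 - t ^ n) powr (1 / p))"

definition mu :: "real \<Rightarrow> nat \<Rightarrow> real" where
  "mu m n = integral {1..} (\<lambda>t. 1 / (t ^ n - 1) powr ((m - 1) / m))"

definition nu :: "real \<Rightarrow> nat \<Rightarrow> real" where
  "nu m n = integral {0..} (\<lambda>t. 1 / (1 + t ^ n) powr ((m - 1) / m))"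

end

theory Submission
  imports Defs
begin

text \<open>
  Write \<open>a = 1/n\<close> and \<open>b = 1/p\<close>, so that \<open>0 < a < b < 1\<close>.  The exponent
  \<open>(m - 1)/m\<close> at the conjugate exponent \<open>m = p/(p - 1)\<close> is again \<open>b\<close>, so all three integrals have
  an integrand of the shape \<open>\<bar>1 \<plusminus> t\<^sup>n\<bar> powr (-b)\<close>.  Each one becomes
  Euler's Beta integral under a substitution onto the unit interval:
  \<open>u = t\<^sup>n\<close> gives \<open>\<pi>\<^bsub>p,n\<^esub>/2 = B(a, 1 - b)/n\<close>,
  \<open>u = t powr (-n)\<close> gives \<open>\<mu> = B(b - a, 1 - b)/n\<close>, and
  \<open>u = 1/(1 + t\<^sup>n)\<close> gives \<open>\<nu> = B(b - a, a)/n\<close>.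

  When the first Beta value is divided by either of the others, one Gamma factor cancels and the
  four remaining ones form two reflection pairs \<open>\<Gamma>(x) \<Gamma>(1 - x) = \<pi>/sin(\<pi> x)\<close>.  Hence \<open>\<pi>\<^bsub>p,n\<^esub>/2\<close> divided by the integral is
  \<open>sin(\<pi>(b - a))/sin(\<pi> a)\<close> for \<open>\<mu>\<close> and
  \<open>sin(\<pi>(b - a))/sin(\<pi> b)\<close> for \<open>\<nu>\<close>, and the addition theorem for the
  sine turns them into the stated denominators.
\<close>

lemma Gamma_reflection_real:
  fixes x :: real
  shows "Gamma x * Gamma (1 - x) = pi / sin (pi * x)"
proof -
  have "complex_of_real (Gamma x * Gamma (1 - x)) = of_real (pi / sin (pi * x))"
    using Gamma_reflection_complex[of "of_real x"] Gamma_complex_of_real[of "1 - x"]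
    by (simp add: Gamma_complex_of_real sin_of_real[symmetric])
  then show ?thesis
    by (simp only: of_real_eq_iff)
qed

text \<open>
  The substitution maps onto the open unit interval: the Beta integrand may blow up at both ends,
  and for two of the substitutions below the end \<open>0\<close> stands for \<open>t = \<infinity>\<close>.  Since that integrand is
  nonnegative, its integrability is absolute, as the change of variables for an arbitrary
  measurable domain requires; it yields the convergence of the integral over \<open>S\<close> along with
  its value.
\<close>

lemma has_integral_Beta_substitution:
  fixes f g g' :: "real \<Rightarrow> real"
  assumes "a > 0" "b > 0" "c > 0" and S: "S \<in> sets lebesgue"
    and der: "\<And>x. x \<in> S \<Longrightarrow> (g has_field_derivative g' x) (at x within S)"
    and bij: "bij_betw g S {0<..<1}"
    and eq: "\<And>x. x \<in> S \<Longrightarrow>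
      \<bar>g' x\<bar> * (g x powr (a - 1) * (1 - g x) powr (b - 1)) = c * f x"
  shows "(f has_integral Beta a b / c) S"
proof -
  let ?B = "\<lambda>t::real. t powr (a - 1) * (1 - t) powr (b - 1)"
  have B: "(?B has_integral Beta a b) {0<..<1}"
    using has_integral_Beta_real[of a b] assms(1,2) by (simp add: has_integral_Icc_iff_Ioo)
  then have "?B absolutely_integrable_on {0<..<1}"
    by (intro nonnegative_absolutely_integrable_1) (auto simp: integrable_on_def)
  then have "?B absolutely_integrable_on g ` S \<and> integral (g ` S) ?B = Beta a b"
    using B bij by (simp add: bij_betw_def integral_unique)
  then have *: "(\<lambda>x. \<bar>g' x\<bar> * ?B (g x)) absolutely_integrable_on S \<and>
      integral S (\<lambda>x. \<bar>g' x\<bar> * ?B (g x)) = Beta a b"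
    using has_absolute_integral_change_of_variables_1'[OF S der, of ?B "Beta a b"] bij
    by (simp add: bij_betw_def)
  then have "((\<lambda>x. \<bar>g' x\<bar> * ?B (g x)) has_integral Beta a b) S"
    using absolutely_integrable_on_def has_integral_integrable_integral by blast
  then have "((\<lambda>x. c * f x) has_integral Beta a b) S"
    by (rule has_integral_eq[rotated]) (rule eq)
  then have "((\<lambda>x. (1 / c) * (c * f x)) has_integral (1 / c) * Beta a b) S"
    by (rule has_integral_mult_right)
  then show ?thesis
    using \<open>c > 0\<close> by simp
qed

text \<open>
  In each of the following three integrals a Beta argument is chosen so that the powers
  of \<open>t\<close> coming from the derivative and from the substituted integrand cancel.  The
  conditions on \<open>b\<close> are those of convergence: \<open>b < 1\<close> at the singularity \<open>t = 1\<close>, and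
  \<open>1 / c < b\<close> at infinity.
\<close>

lemma has_integral_one_minus_powr:
  fixes b c :: real
  assumes "c > 0" "b < 1"
  shows "((\<lambda>t. (1 - t powr c) powr (- b)) has_integral Beta (1 / c) (1 - b) / c) {0<..<1}"
proof (rule has_integral_Beta_substitution[where g = "\<lambda>t. t powr c"
      and g' = "\<lambda>t. c * t powr (c - 1)"])
  show "bij_betw (\<lambda>t. t powr c) {0<..<1} {0<..<1::real}"
    using assms
    by (intro bij_betw_byWitness[where f' = "\<lambda>u. u powr (1 / c)"])
      (auto simp: powr_powr powr01_less_one)
  fix t :: real assume t: "t \<in> {0<..<1}"
  then show "((\<lambda>t. t powr c) has_field_derivative c * t powr (c - 1)) (at t within {0<..<1})"
    by (auto intro!: derivative_eq_intros)
  have "t powr (c - 1) * (t powr c) powr (1 / c - 1) = t powr 0"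
    using assms unfolding powr_powr powr_add[symmetric] by (simp add: field_simps)
  then have "t powr (c - 1) * (t powr c) powr (1 / c - 1) = 1"
    using t by simp
  then show "\<bar>c * t powr (c - 1)\<bar> *
      ((t powr c) powr (1 / c - 1) * (1 - t powr c) powr (1 - b - 1)) =
      c * (1 - t powr c) powr (- b)"
    using assms by (simp add: abs_mult flip: mult.assoc)
qed (use assms in auto)

text \<open>
  Passing to \<open>u = t powr (- c)\<close> sends infinity to \<open>0\<close> and fixes the singularity at
  \<open>1\<close>, so decay at infinity determines the first Beta argument and the singularity the second.
\<close>

lemma has_integral_powr_minus_one:
  fixes b c :: real
  assumes "c > 0" "1 / c < b" "b < 1"
  shows "((\<lambda>t. (t powr c - 1) powr (- b)) has_integral Beta (b - 1 / c) (1 - b) / c) {1<..}"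
proof (rule has_integral_Beta_substitution[where g = "\<lambda>t. t powr (- c)"
      and g' = "\<lambda>t. - c * t powr (- c - 1)"])
  have "t powr (- c) < 1" if "1 < t" for t :: real
    using assms that powr_less_mono[of "- c" 0 t] by simp
  moreover have "u powr (- (1 / c)) > 1" if "0 < u" "u < 1" for u :: real
    using assms that powr_less_mono'[of u 0 "- (1 / c)"] powr_less_mono2_neg[of "- (1 / c)" u 1]
    by simp
  ultimately show "bij_betw (\<lambda>t. t powr (- c)) {1<..} {0<..<1::real}"
    using assms
    by (intro bij_betw_byWitness[where f' = "\<lambda>u. u powr (- (1 / c))"])
      (auto simp: powr_powr)
  fix t :: real assume t: "t \<in> {1<..}"
  then show "((\<lambda>t. t powr (- c)) has_field_derivative - c * t powr (- c - 1)) (at t within {1<..})"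
    by (auto intro!: derivative_eq_intros)
  have "1 - t powr (- c) = (t powr c - 1) * t powr (- c)"
    using t by (simp add: algebra_simps flip: powr_add)
  moreover have "t powr c > 1"
    using t assms by simp
  ultimately have "(1 - t powr (- c)) powr (1 - b - 1) = (t powr c - 1) powr (- b) * t powr (c * b)"
    by (simp add: powr_mult powr_powr)
  moreover have "t powr (- c - 1) * (t powr (- c)) powr (b - 1 / c - 1) * t powr (c * b) = t powr 0"
    using assms unfolding powr_powr powr_add[symmetric] by (simp add: field_simps)
  then have "t powr (- c - 1) * (t powr (- c)) powr (b - 1 / c - 1) * t powr (c * b) = 1"
    using t by simp
  ultimately show "\<bar>- c * t powr (- c - 1)\<bar> *
      ((t powr (- c)) powr (b - 1 / c - 1) * (1 - t powr (- c)) powr (1 - b - 1)) =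
      c * (t powr c - 1) powr (- b)"
    using assms by (simp add: abs_mult mult_ac)
qed (use assms in auto)

text \<open>
  Here \<open>u = 1 / (1 + t powr c)\<close> makes the base of the integrand itself the variable, and
  \<open>1 - u = t powr c / (1 + t powr c)\<close> supplies the power of \<open>t\<close> that cancels the
  \<open>t powr (c - 1)\<close> of the derivative.
\<close>

lemma has_integral_one_plus_powr:
  fixes b c :: real
  assumes "c > 0" "1 / c < b"
  shows "((\<lambda>t. (1 + t powr c) powr (- b)) has_integral Beta (b - 1 / c) (1 / c) / c) {0<..}"
proof (rule has_integral_Beta_substitution[where g = "\<lambda>t. 1 / (1 + t powr c)"
      and g' = "\<lambda>t. - (c * t powr (c - 1)) / (1 + t powr c)\<^sup>2"])
  have pos: "1 + t powr c > 0" for t :: real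
    by (simp add: add_pos_nonneg)
  have inv: "(1 / (1 + t powr c) > 0 \<and> 1 / (1 + t powr c) < 1) \<and>
      (1 / (1 / (1 + t powr c)) - 1) powr (1 / c) = t" if "0 < t" for t :: real
    using that assms pos[of t] by (auto simp: powr_powr)
  have "1 / (1 + ((1 / u - 1) powr (1 / c)) powr c) = u" if "0 < u" "u < 1" for u :: real
    using that assms by (simp add: powr_powr)
  then show "bij_betw (\<lambda>t. 1 / (1 + t powr c)) {0<..} {0<..<1::real}"
    using inv by (intro bij_betw_byWitness[where f' = "\<lambda>u. (1 / u - 1) powr (1 / c)"]) auto
  fix t :: real assume t: "t \<in> {0<..}"
  then show "((\<lambda>t. 1 / (1 + t powr c)) has_field_derivative
      - (c * t powr (c - 1)) / (1 + t powr c)\<^sup>2) (at t within {0<..})"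
    using pos[of t] by (auto intro!: derivative_eq_intros simp: power2_eq_square)
  define T where "T = 1 + t powr c"
  have T: "T > 0"
    using pos by (simp add: T_def)
  have g: "1 / T = T powr (- 1)"
    using T by (simp add: powr_minus_divide)
  have g1: "1 - T powr (- 1) = t powr c * T powr (- 1)"
    using T by (simp add: powr_minus_divide field_simps) (simp add: T_def)
  have T_part: "T powr (- 2) * (T powr (- 1)) powr (b - 1 / c - 1) * (T powr (- 1)) powr (1 / c - 1) =
      T powr (- b)"
    unfolding powr_powr powr_add[symmetric] by simp
  have "t powr (c - 1) * (t powr c) powr (1 / c - 1) = t powr 0"
    using assms unfolding powr_powr powr_add[symmetric] by (simp add: field_simps)
  then have t_part: "t powr (c - 1) * (t powr c) powr (1 / c - 1) = 1"
    using t by simp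
  have split: "(t powr c * T powr (- 1)) powr (1 / c - 1) =
      (t powr c) powr (1 / c - 1) * (T powr (- 1)) powr (1 / c - 1)"
    by (simp only: powr_mult powr_ge_zero)
  have abs_deriv: "\<bar>- (c * t powr (c - 1)) / T\<^sup>2\<bar> = c * t powr (c - 1) * T powr (- 2)"
    using T assms by (simp add: abs_mult powr_minus_divide powr_numeral)
  have "\<bar>- (c * t powr (c - 1)) / T\<^sup>2\<bar> *
      ((T powr (- 1)) powr (b - 1 / c - 1) * (t powr c * T powr (- 1)) powr (1 / c - 1)) =
      c * (t powr (c - 1) * (t powr c) powr (1 / c - 1)) *
      (T powr (- 2) * (T powr (- 1)) powr (b - 1 / c - 1) * (T powr (- 1)) powr (1 / c - 1))"
    by (simp only: split abs_deriv mult_ac)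
  then have "\<bar>- (c * t powr (c - 1)) / T\<^sup>2\<bar> *
      ((T powr (- 1)) powr (b - 1 / c - 1) * (t powr c * T powr (- 1)) powr (1 / c - 1)) =
      c * T powr (- b)"
    by (simp only: T_part t_part mult_1_right)
  then show "\<bar>- (c * t powr (c - 1)) / (1 + t powr c)\<^sup>2\<bar> *
      ((1 / (1 + t powr c)) powr (b - 1 / c - 1) * (1 - 1 / (1 + t powr c)) powr (1 / c - 1)) =
      c * (1 + t powr c) powr (- b)"
    unfolding T_def[symmetric] g g1 .
qed (use assms in auto)

lemma pi_pn_eq_Beta:
  assumes "p > 1" "n > 0"
  shows "pi_pn p n = 2 * (Beta (1 / real n) (1 - 1 / p) / real n)"
proof -
  have "((\<lambda>t. 1 / (1 - t ^ n) powr (1 / p)) has_integral Beta (1 / real n) (1 - 1 / p) / real n) {0<..<1}"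
    by (rule has_integral_eq[OF _ has_integral_one_minus_powr])
      (use assms in \<open>auto simp: powr_realpow powr_minus_divide\<close>)
  then show ?thesis
    by (simp add: pi_pn_def has_integral_Icc_iff_Ioo[symmetric] integral_unique)
qed

lemma mu_conj_exponent_eq_Beta:
  assumes "p > 1" "n > 0" "p < real n"
  shows "mu (conj_exponent p) n = Beta (1 / p - 1 / real n) (1 - 1 / p) / real n"
proof -
  have m: "(conj_exponent p - 1) / conj_exponent p = 1 / p"
    using assms by (simp add: conj_exponent_def field_simps)
  have "((\<lambda>t. 1 / (t ^ n - 1) powr (1 / p)) has_integral
      Beta (1 / p - 1 / real n) (1 - 1 / p) / real n) {1<..}"
    by (rule has_integral_eq[OF _ has_integral_powr_minus_one])
      (use assms in \<open>auto simp: powr_realpow powr_minus_divide frac_less2\<close>)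
  moreover have "integral {1..} f = integral {1<..} f" for f :: "real \<Rightarrow> real"
    by (rule integral_spike_set) (rule negligible_subset[of "{1}"]; force)+
  ultimately show ?thesis
    by (simp add: mu_def m integral_unique)
qed

lemma nu_conj_exponent_eq_Beta:
  assumes "p > 1" "n > 0" "p < real n"
  shows "nu (conj_exponent p) n = Beta (1 / p - 1 / real n) (1 / real n) / real n"
proof -
  have m: "(conj_exponent p - 1) / conj_exponent p = 1 / p"
    using assms by (simp add: conj_exponent_def field_simps)
  have "((\<lambda>t. 1 / (1 + t ^ n) powr (1 / p)) has_integral
      Beta (1 / p - 1 / real n) (1 / real n) / real n) {0<..}"
    by (rule has_integral_eq[OF _ has_integral_one_plus_powr])
      (use assms in \<open>auto simp: powr_realpow powr_minus_divide frac_less2\<close>)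
  moreover have "integral {0..} f = integral {0<..} f" for f :: "real \<Rightarrow> real"
    by (rule integral_spike_set) (rule negligible_subset[of "{0}"]; force)+
  ultimately show ?thesis
    by (simp add: nu_def m integral_unique)
qed

text \<open>
  Both quotients share the reflection pair of \<open>b - a\<close>; the other pair is that of \<open>a\<close> when
  \<open>\<Gamma>(1 - b)\<close> cancels, and that of \<open>b\<close> when \<open>\<Gamma>(a)\<close> cancels.
\<close>

lemma Beta_ratios:
  fixes a b :: real
  assumes "0 < a" "a < b" "b < 1"
  shows "Beta a (1 - b) * sin (pi * a) = Beta (b - a) (1 - b) * sin (pi * (b - a))"
    and "Beta a (1 - b) * sin (pi * b) = Beta (b - a) a * sin (pi * (b - a))"
proof -
  have sin_pos: "sin (pi * x) > 0" if "0 < x" "x < 1" for x :: real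
    using that by (intro sin_gt_zero) auto
  have G: "Gamma x > 0" if "0 < x" for x :: real
    using that by (rule Gamma_real_pos)
  have s: "sin (pi * x) = pi / (Gamma x * Gamma (1 - x))" if "0 < x" "x < 1" for x :: real
    using sin_pos[OF that] Gamma_reflection_real[of x] by simp
  have pos: "Gamma a > 0" "Gamma (1 - a) > 0" "Gamma b > 0" "Gamma (1 - b) > 0"
    "Gamma (b - a) > 0" "Gamma (1 + a - b) > 0"
    using assms by (auto intro!: G)
  have sab: "sin (pi * a) = pi / (Gamma a * Gamma (1 - a))"
    "sin (pi * b) = pi / (Gamma b * Gamma (1 - b))"
    "sin (pi * (b - a)) = pi / (Gamma (b - a) * Gamma (1 - (b - a)))"
    by (rule s; use assms in simp)+
  have eqs: "a + (1 - b) = 1 + a - b" "b - a + (1 - b) = 1 - a" "b - a + a = b" "1 - (b - a) = 1 + a - b"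
    by simp_all
  show "Beta a (1 - b) * sin (pi * a) = Beta (b - a) (1 - b) * sin (pi * (b - a))"
    "Beta a (1 - b) * sin (pi * b) = Beta (b - a) a * sin (pi * (b - a))"
    unfolding Beta_def sab eqs using pos by simp_all
qed

theorem theorem1p3:
  fixes p :: real and n :: nat
  assumes "p > 1" and "n > 1" and "p < real n"
  shows "mu (conj_exponent p) n =
           pi_pn p n / (2 * (sin (pi / p) * cot (pi / real n) - cos (pi / p))) \<and>
         nu (conj_exponent p) n =
           pi_pn p n / (2 * (cos (pi / real n) - sin (pi / real n) * cot (pi / p)))"
proof -
  define a b where "a = 1 / real n" and "b = 1 / p"
  have ab: "0 < a" "a < b" "b < 1"
    using assms by (auto simp: a_def b_def frac_less2)
  have sin_pos: "sin (pi * x) > 0" if "0 < x" "x < 1" for x :: real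
    using that by (intro sin_gt_zero) auto
  have pos: "sin (pi * a) > 0" "sin (pi * b) > 0" "sin (pi * (b - a)) > 0"
    using ab by (auto intro!: sin_pos)
  have sin_diff: "sin (pi * (b - a)) = sin (pi * b) * cos (pi * a) - cos (pi * b) * sin (pi * a)"
    by (simp only: right_diff_distrib sin_diff)
  have "Beta (b - a) (1 - b) = Beta a (1 - b) / (sin (pi * (b - a)) / sin (pi * a))"
    "Beta (b - a) a = Beta a (1 - b) / (sin (pi * (b - a)) / sin (pi * b))"
    using pos Beta_ratios[OF ab] by (simp_all add: eq_divide_eq)
  moreover have "sin (pi * b) * cot (pi * a) - cos (pi * b) = sin (pi * (b - a)) / sin (pi * a)"
    using pos by (simp add: sin_diff cot_def diff_divide_distrib)
  moreover have "cos (pi * a) - sin (pi * a) * cot (pi * b) = sin (pi * (b - a)) / sin (pi * b)"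
    using pos by (simp add: sin_diff cot_def diff_divide_distrib)
  moreover have "mu (conj_exponent p) n = Beta (b - a) (1 - b) / real n"
    "nu (conj_exponent p) n = Beta (b - a) a / real n"
    "pi_pn p n = 2 * (Beta a (1 - b) / real n)"
    using assms mu_conj_exponent_eq_Beta nu_conj_exponent_eq_Beta pi_pn_eq_Beta
    by (simp_all add: a_def b_def)
  moreover have "pi / p = pi * b" "pi / real n = pi * a"
    by (simp_all add: a_def b_def)
  ultimately show ?thesis
    by (simp only: mult_divide_mult_cancel_left_if) simp
qed

end
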